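(* Let $h\in(0,\infty)$, $\sigma\in(0,\infty)$ and $w\in\mathbb{R}$. Then: (I) the four suprema are all the same: $$\mathcal{S}_{h,w,\le\sigma}=\mathcal{S}_{h,w,\sigma}=\mathcal{S}^{(2)}_{h,w,\sigma}=\mathcal{S}^{(2)}_{h,w,\le\sigma};$$ (II) each of these four suprema is (strictly) increasing in $\sigma\in(0,\infty)$ (for fixed $h$ and $w$); (III) each of these suprema is attained, and the attainment sets satisfy $$\mathcal{A}_{h,w,\le\sigma}=\mathcal{A}_{h,w,\sigma}=\mathcal{A}^{(2)}_{h,w,\sigma}=\mathcal{A}^{(2)}_{h,w,\le\sigma}.$$
   Context: Notation: $x\wedge w=\min(x,w)$. $\mathcal{P}$ is the set of all Borel probability measures on $\mathbb{R}$. For positive real $u,v$, $P_{u,v}$ denotes the unique zero-mean probability distribution on the two-point set $\{-u,v\}$; its variance is $uv$. For $h,\sigma\in(0,\infty)$ and $w\in\mathbb{R}$ define $\mathcal{P}_\sigma:=\{P\in\mathcal{P}\colon \int_{\mathbb{R}} x\,P(dx)=0,\ \int_{\mathbb{R}} x^2\,P(dx)=\sigma^2\}$, $\mathcal{P}_{\le\sigma}:=\{P\in\mathcal{P}\colon \int_{\mathbb{R}} x\,P(dx)=0,\ \int_{\mathbb{R}} x^2\,P(dx)\in(0,\sigma^2]\}$, $\mathcal{P}^{(2)}_{w,\sigma}:=\{P_{u,v}\colon -\infty<-u<w\le v<\infty,\ uv=\sigma^2\}$, $\mathcal{P}^{(2)}_{w,\le\sigma}:=\{P_{u,v}\colon -\infty<-u<w\le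 v<\infty,\ uv\in(0,\sigma^2]\}$ (the conditions $-u<w\le v$ and $uv>0$ force $u>0$, $v>0$). The Winsorised-tilted mean of $P$ is $$\mathsf{M}_{h,w}P:=\frac{\int_{\mathbb{R}} x e^{h(x\wedge w)}P(dx)}{\int_{\mathbb{R}} e^{h(x\wedge w)}P(dx)}.$$ The suprema $\mathcal{S}_{h,w,\sigma}$, $\mathcal{S}_{h,w,\le\sigma}$, $\mathcal{S}^{(2)}_{h,w,\sigma}$, $\mathcal{S}^{(2)}_{h,w,\le\sigma}$ are the suprema of $\mathsf{M}_{h,w}P$ over $P$ in $\mathcal{P}_\sigma$, $\mathcal{P}_{\le\sigma}$, $\mathcal{P}^{(2)}_{w,\sigma}$, $\mathcal{P}^{(2)}_{w,\le\sigma}$, respectively. The attainment sets $\mathcal{A}_{h,w,\sigma}$, $\mathcal{A}_{h,w,\le\sigma}$, $\mathcal{A}^{(2)}_{h,w,\sigma}$, $\mathcal{A}^{(2)}_{h,w,\le\sigma}$ are the sets of all $P$ in $\mathcal{P}_\sigma$, $\mathcal{P}_{\le\sigma}$, $\mathcal{P}^{(2)}_{w,\sigma}$, $\mathcal{P}^{(2)}_{w,\le\sigma}$, respectively, at which $\mathsf{M}_{h,w}P$ equals the corresponding supremum. *)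

theory Defs
  imports "HOL-Probability.Probability"
begin

definition zero_mean :: "real measure \<Rightarrow> bool" where
  "zero_mean P \<longleftrightarrow> integrable P (\<lambda>x. x) \<and> (\<integral>x. x \<partial>P) = 0"

text \<open>Meaningful for positive \<open>u\<close>, \<open>v\<close> only; see \<open>two_point_ex1\<close> and \<open>two_point_eq\<close> below.\<close>

definition two_point :: "real \<Rightarrow> real \<Rightarrow> real measure" where
  "two_point u v =
     (THE P. real_distribution P \<and> measure P {-u, v} = 1 \<and> zero_mean P)"

definition prob_eq :: "real \<Rightarrow> real measure set" where
  "prob_eq \<sigma> = {P. real_distribution P \<and> zero_mean P \<and>
     integrable P (\<lambda>x. x\<^sup>2) \<and> (\<integral>x. x\<^sup>2 \<partial>P) = \<sigma>\<^sup>2}"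

definition prob_le :: "real \<Rightarrow> real measure set" where
  "prob_le \<sigma> = {P. real_distribution P \<and> zero_mean P \<and>
     integrable P (\<lambda>x. x\<^sup>2) \<and> (\<integral>x. x\<^sup>2 \<partial>P) \<in> {0<..\<sigma>\<^sup>2}}"

text \<open>In the next two definitions the side conditions force \<open>0 < u\<close> and \<open>0 < v\<close>
  when \<open>\<sigma> \<noteq> 0\<close> (lemma \<open>two_point_params_pos\<close>).\<close>

definition prob2_eq :: "real \<Rightarrow> real \<Rightarrow> real measure set" where
  "prob2_eq w \<sigma> = {two_point u v | u v. -u < w \<and> w \<le> v \<and> u * v = \<sigma>\<^sup>2}"

definition prob2_le :: "real \<Rightarrow> real \<Rightarrow> real measure set" where
  "prob2_le w \<sigma> = {two_point u v | u v. -u < w \<and> w \<le> v \<and> u * v \<in> {0<..\<sigma>\<^sup>2}}"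

text \<open>The Winsorised-tilted mean: only the exponent is capped at \<open>w\<close>, not the averaged \<open>x\<close>.\<close>

definition wt_mean :: "real \<Rightarrow> real \<Rightarrow> real measure \<Rightarrow> real" where
  "wt_mean h w P =
     (\<integral>x. x * exp (h * min x w) \<partial>P) / (\<integral>x. exp (h * min x w) \<partial>P)"

text \<open>The supremum is taken in the extended reals, so that no boundedness is presupposed.\<close>

definition wt_sup :: "real \<Rightarrow> real \<Rightarrow> real measure set \<Rightarrow> ereal" where
  "wt_sup h w Q = (SUP P\<in>Q. ereal (wt_mean h w P))"

definition wt_attain :: "real \<Rightarrow> real \<Rightarrow> real measure set \<Rightarrow> real measure set" where
  "wt_attain h w Q = {P \<in> Q. ereal (wt_mean h w P) = wt_sup h w Q}"

lemma two_point_params_pos: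
  fixes u v w :: real
  assumes "-u < w" "w \<le> v" "0 < u * v"
  shows "0 < u \<and> 0 < v"
  using assms by (auto simp: zero_less_mult_iff)

lemma two_point_masses:
  fixes u v :: real
  assumes uv: "0 < u" "0 < v"
    and P: "real_distribution P" "measure P {-u, v} = 1" "zero_mean P"
  shows "measure P {-u} = v / (u + v)" "measure P {v} = u / (u + v)"
proof -
  interpret real_distribution P by fact
  have 1: "measure P {-u} + measure P {v} = 1"
  proof -
    have "measure P ({-u} \<union> {v}) = measure P {-u} + measure P {v}"
      by (rule finite_measure_Union) (use uv in auto)
    moreover have "{-u} \<union> {v} = {-u, v}" by auto
    ultimately show ?thesis using P(2) by simp
  qed
  have ae: "AE x in P. x \<in> {-u, v}"
    using P(2) by (subst AE_in_set_eq_1) auto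
  have "(\<integral>x. x \<partial>P) = (\<integral>x. (-u) * indicator {-u} x + v * indicator {v} x \<partial>P)"
    by (rule integral_cong_AE) (use ae uv in \<open>auto split: split_indicator\<close>)
  also have "\<dots> = -u * measure P {-u} + v * measure P {v}"
    by (subst Bochner_Integration.integral_add) (auto simp: less_top[symmetric])
  finally have "-u * measure P {-u} + v * measure P {v} = 0"
    using P(3) by (simp add: zero_mean_def)
  moreover have "measure P {v} = 1 - measure P {-u}" using 1 by simp
  ultimately have "measure P {-u} * (u + v) = v" by (simp add: algebra_simps)
  then show 2: "measure P {-u} = v / (u + v)" using uv by (simp add: field_simps)
  show "measure P {v} = u / (u + v)"
    using 1 2 uv by (simp add: field_simps)
qed

lemma two_point_unique:
  fixes u v :: real
  assumes uv: "0 < u" "0 < v"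
    and P: "real_distribution P" "measure P {-u, v} = 1" "zero_mean P"
    and Q: "real_distribution Q" "measure Q {-u, v} = 1" "zero_mean Q"
  shows "P = Q"
proof -
  interpret P: real_distribution P by fact
  interpret Q: real_distribution Q by fact
  have main: "measure R A = (\<Sum>x\<in>A \<inter> {-u, v}. measure R {x})"
    if "real_distribution R" "measure R {-u, v} = 1" "A \<in> sets borel" for R :: "real measure" and A
  proof -
    interpret R: real_distribution R by fact
    have ae: "AE x in R. x \<in> {-u, v}"
      using that(2) by (subst R.AE_in_set_eq_1) auto
    have "measure R A = measure R (A \<inter> {-u, v})"
      by (rule R.finite_measure_eq_AE) (use ae that(3) in auto)
    also have "\<dots> = (\<Sum>x\<in>A \<inter> {-u, v}. measure R {x})"
      by (rule R.finite_measure_eq_sum_singleton) auto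
    finally show ?thesis .
  qed
  show ?thesis
  proof (rule measure_eqI)
    fix A assume "A \<in> sets P"
    then have A: "A \<in> sets borel" by simp
    have "measure P A = measure Q A"
      unfolding main[OF P(1,2) A] main[OF Q(1,2) A]
      using two_point_masses[OF uv P] two_point_masses[OF uv Q] by (intro sum.cong) auto
    then show "emeasure P A = emeasure Q A"
      by (simp add: P.emeasure_eq_measure Q.emeasure_eq_measure)
  qed simp
qed

lemma two_point_exists:
  fixes u v :: real
  assumes uv: "0 < u" "0 < v"
  defines "P \<equiv> distr (measure_pmf (bernoulli_pmf (u / (u + v)))) borel (\<lambda>b. if b then v else -u)"
  shows "real_distribution P \<and> measure P {-u, v} = 1 \<and> zero_mean P"
proof (intro conjI)
  show "real_distribution P"
    unfolding P_def by (rule prob_space.real_distribution_distr) (simp_all add: measure_pmf.prob_space_axioms)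
  have p: "0 \<le> u / (u + v)" "u / (u + v) \<le> 1" using uv by auto
  have "(\<lambda>b. if b then v else -u) -` {-u, v} = UNIV" by auto
  then show "measure P {-u, v} = 1"
    unfolding P_def by (subst measure_distr) (auto simp: measure_pmf.prob_space)
  have "(\<integral>x. x \<partial>P) = (\<integral>b. (if b then v else -u) \<partial>measure_pmf (bernoulli_pmf (u / (u + v))))"
    unfolding P_def by (subst integral_distr) auto
  also have "\<dots> = 0"
    using p uv by (simp add: field_simps)
  finally have "(\<integral>x. x \<partial>P) = 0" .
  moreover have "integrable P (\<lambda>x. x)"
    unfolding P_def by (subst integrable_distr_eq) (auto intro!: integrable_measure_pmf_finite)
  ultimately show "zero_mean P" by (simp add: zero_mean_def)
qed

lemma two_point_ex1:
  assumes "0 < u" "0 < v"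
  shows "\<exists>!P. real_distribution P \<and> measure P {-u, v} = 1 \<and> zero_mean P"
  using two_point_exists[OF assms] two_point_unique[OF assms] by blast

lemma two_point_eq:
  assumes "0 < u" "0 < v"
  shows "two_point u v =
    distr (measure_pmf (bernoulli_pmf (u / (u + v)))) borel (\<lambda>b. if b then v else -u)"
  unfolding two_point_def
  by (rule the1_equality[OF two_point_ex1[OF assms] two_point_exists[OF assms]])

end

theory Submission
  imports Defs
begin

text \<open>
  All four classes share one maximiser, and it is unique.  Maximising the tilted mean over the
  two-point laws of variance \<open>\<sigma>\<^sup>2\<close> is a one-variable problem, whose maximum \<open>t > 0\<close> is attained at
  some \<open>P\<^bsub>u,v\<^esub>\<close> (\<open>optimal_two_point_exists\<close>).  For a general law \<open>P\<close>, the inequality between its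
  tilted mean and \<open>t\<close> is linear in \<open>P\<close>: up to the factor \<open>exp (h * w)\<close>, it says that
  \<open>g x = (x - t) * exp (h * (min x w - w))\<close> has nonpositive integral.  As only the first two moments
  of \<open>P\<close> are controlled, the dual certificate is a parabola \<open>q \<ge> g\<close> whose integral depends on the
  variance alone.

  The parabola has to touch \<open>g\<close> exactly at the two atoms \<open>-u\<close> and \<open>v\<close>.  That is one condition more
  than a parabola can meet, and the missing equation is the first-order condition for the optimality
  of \<open>u\<close> (\<open>first_order_conditions\<close>); if \<open>v = w\<close> sits at the edge of the parameter range, the
  condition is only an inequality, but there \<open>g\<close> has a concave kink and leaves the slope of \<open>q\<close> at
  \<open>v\<close> room to exceed the slope of \<open>g\<close> on the right.  That \<open>q\<close> lies above \<open>g\<close> everywhere and meets it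
  at the atoms only is \<open>parabola_majorant\<close>; to the left of \<open>w\<close> it follows from the fact that the second
  derivative of \<open>q - g\<close> changes sign at most once (\<open>single_crossing_touching_pos\<close>).

  Since \<open>q\<close> opens upwards, its integral under a centred law of variance at most \<open>\<sigma>\<^sup>2\<close> is at most its
  integral under \<open>P\<^bsub>u,v\<^esub>\<close>, which is that of \<open>g\<close>, namely \<open>0\<close>.  So \<open>t\<close> bounds every tilted mean; equality
  forces \<open>P\<close> to live on \<open>{-u, v}\<close>, hence to be \<open>P\<^bsub>u,v\<^esub>\<close> (\<open>unique_maximiser\<close>).  As this law lies in all
  four classes, the suprema agree and each attainment set is its singleton.  Strict monotonicity is
  uniqueness once more: the maximiser for a smaller standard deviation competes for a larger one,
  but has the wrong variance to be the maximiser there.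
\<close>

section \<open>A parabola above the tilted linear function\<close>

text \<open>
  The hypothesis \<open>crossing\<close> says that \<open>D\<close> is first convex and then concave.  Where \<open>D\<close> is convex it
  stays above its tangent at \<open>p\<close>; and if it were to come down to \<open>0\<close> on the right of \<open>p\<close>, it would have
  entered the concave region while decreasing and could not be nonnegative at \<open>w\<close> any more.
\<close>

lemma single_crossing_touching_pos:
  fixes D D' D'' :: "real \<Rightarrow> real"
  assumes D: "\<And>x. (D has_real_derivative D' x) (at x)"
    and D': "\<And>x. (D' has_real_derivative D'' x) (at x)"
    and crossing: "\<And>a b. a < b \<Longrightarrow> D'' a \<le> 0 \<Longrightarrow> D'' b < 0"
    and touch: "D p = 0" "D' p = 0"
    and right: "p < w" "0 \<le> D w"
    and x: "x < w" "x \<noteq> p"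
  shows "0 < D x"
proof (rule ccontr)
  assume "\<not> 0 < D x"
  then have neg: "D x \<le> 0" by simp
  \<comment> \<open>A nonpositive slope in the concave region stays negative and would make D w negative.\<close>
  have late: False if "p \<le> \<eta>" "\<eta> \<le> \<xi>" "\<xi> \<le> y" "y < w" "D y \<le> 0" "D' \<xi> \<le> 0" "D'' \<eta> \<le> 0" for \<eta> \<xi> y
  proof -
    obtain z where z: "y < z" "z < w" "D w - D y = (w - y) * D' z"
      using MVT2[OF \<open>y < w\<close>, of D D'] D by blast
    have "\<xi> < z" using that z by simp
    then obtain z' where z': "\<xi> < z'" "z' < z" "D' z - D' \<xi> = (z - \<xi>) * D'' z'"
      using MVT2[of \<xi> z D' D''] D' by blast
    have "D'' z' < 0" using crossing[of \<eta> z'] that z' by simp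
    then have "D' z - D' \<xi> < 0"
      unfolding z'(3) using \<open>\<xi> < z\<close> by (simp add: mult_less_0_iff)
    then have "D' z < 0" using that by simp
    then have "D w - D y < 0"
      unfolding z(3) using \<open>y < w\<close> by (simp add: mult_less_0_iff)
    then show False using that right by simp
  qed
  have pos_p: "0 < D'' p"
    using late[of p p p] touch right by force
  show False
  proof (cases "x < p")
    case True
    obtain \<xi> where \<xi>: "x < \<xi>" "\<xi> < p" "D p - D x = (p - x) * D' \<xi>"
      using MVT2[OF True, of D D'] D by blast
    obtain \<eta> where \<eta>: "\<xi> < \<eta>" "\<eta> < p" "D' p - D' \<xi> = (p - \<xi>) * D'' \<eta>"
      using MVT2[OF \<open>\<xi> < p\<close>, of D' D''] D' by blast
    have "0 < D'' \<eta>" using crossing[of \<eta> p] pos_p \<eta> by force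
    then have "0 < D' p - D' \<xi>" unfolding \<eta>(3) using \<xi> by simp
    then have "D' \<xi> < 0" using touch by simp
    then have "D p - D x < 0"
      unfolding \<xi>(3) using True by (simp add: mult_less_0_iff)
    then show False using neg touch by simp
  next
    case False
    then have "p < x" using x by simp
    obtain \<xi> where \<xi>: "p < \<xi>" "\<xi> < x" "D x - D p = (x - p) * D' \<xi>"
      using MVT2[OF \<open>p < x\<close>, of D D'] D by blast
    obtain \<eta> where \<eta>: "p < \<eta>" "\<eta> < \<xi>" "D' \<xi> - D' p = (\<xi> - p) * D'' \<eta>"
      using MVT2[OF \<open>p < \<xi>\<close>, of D' D''] D' by blast
    have "(x - p) * D' \<xi> \<le> 0" using \<xi>(3) neg touch by simp
    then have d': "D' \<xi> \<le> 0" using \<open>p < x\<close> by (simp add: mult_le_0_iff)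
    then have "(\<xi> - p) * D'' \<eta> \<le> 0" using \<eta>(3) touch by simp
    then have "D'' \<eta> \<le> 0" using \<xi> by (simp add: mult_le_0_iff)
    then show False using late[of \<eta> \<xi> x] d' \<xi> \<eta> neg x by simp
  qed
qed

text \<open>
  On \<open>[w, \<infinity>)\<close> the tilted function is the line \<open>x - t\<close>, and \<open>q\<close> is written so that its difference from
  this line is visibly nonnegative.  On \<open>(-\<infinity>, w]\<close> the second derivative of \<open>(x - t) * exp (h * (x - w))\<close>
  is strictly increasing wherever it is positive, so once it has reached the constant second derivative
  \<open>2 * c > 0\<close> of \<open>q\<close> it exceeds it from there on, which is the single-crossing property.
\<close>

lemma parabola_majorant:
  fixes h w t u v s c :: real
  defines "q \<equiv> \<lambda>x. (v - t) + s * (x - v) + c * (x - v)\<^sup>2"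
  assumes h: "0 < h" and uv: "- u < w" "w \<le> v"
    and c: "0 < c" and s: "1 \<le> s" "v = w \<or> s = 1"
    and touch: "q (- u) = (- u - t) * exp (h * (- u - w))"
    and tangent: "s - 2 * c * (u + v) = (1 + h * (- u - t)) * exp (h * (- u - w))"
  shows "(x - t) * exp (h * (min x w - w)) \<le> q x"
    and "x \<notin> {- u, v} \<Longrightarrow> (x - t) * exp (h * (min x w - w)) < q x"
proof -
  \<comment> \<open>The difference left of w, extended to the whole line by the same formula.\<close>
  define D where "D = (\<lambda>x. q x - (x - t) * exp (h * (x - w)))"
  define D' where "D' = (\<lambda>x. s + 2 * c * (x - v) - (1 + h * (x - t)) * exp (h * (x - w)))"
  define D'' where "D'' = (\<lambda>x. 2 * c - h * ((2 + h * (x - t)) * exp (h * (x - w))))"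
  have D: "(D has_real_derivative D' y) (at y)" for y
    unfolding D_def D'_def q_def
    by (rule derivative_eq_intros refl | simp add: algebra_simps)+
  have D': "(D' has_real_derivative D'' y) (at y)" for y
    unfolding D'_def D''_def
    by (rule derivative_eq_intros refl | simp add: algebra_simps)+
  have crossing: "D'' b < 0" if "a < b" "D'' a \<le> 0" for a b
  proof -
    have "2 * c \<le> h * ((2 + h * (a - t)) * exp (h * (a - w)))"
      using that(2) by (simp add: D''_def)
    moreover have "0 < h * ((2 + h * (a - t)) * exp (h * (a - w)))"
      using calculation c by linarith
    then have pos: "0 < 2 + h * (a - t)"
      using h by (simp add: zero_less_mult_iff)
    have "h * (a - t) < h * (b - t)" using h that(1) by simp
    with pos have "0 < 2 + h * (b - t)" by linarith
    then have "(2 + h * (a - t)) * exp (h * (a - w)) < (2 + h * (b - t)) * exp (h * (b - w))"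
      using h that(1) by (intro mult_strict_mono) auto
    then have "h * ((2 + h * (a - t)) * exp (h * (a - w))) < h * ((2 + h * (b - t)) * exp (h * (b - w)))"
      using h by simp
    ultimately show ?thesis by (simp add: D''_def)
  qed
  have right: "q y - (y - t) = (s - 1) * (y - v) + c * (y - v)\<^sup>2" for y
    by (simp add: q_def algebra_simps)
  have right_nonneg: "0 \<le> q y - (y - t)" if "w \<le> y" for y
    unfolding right using s c that by auto
  have right_pos: "0 < q y - (y - t)" if "w \<le> y" "y \<noteq> v" for y
    unfolding right using s c that by (auto intro!: add_nonneg_pos)
  have left_pos: "0 < D y" if "y < w" "y \<noteq> - u" for y
  proof (rule single_crossing_touching_pos[OF D D' crossing _ _ uv(1) _ that])
    show "D (- u) = 0" using touch by (simp add: D_def)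
    show "D' (- u) = 0" using tangent by (simp add: D'_def algebra_simps)
    show "0 \<le> D w" using right_nonneg[of w] by (simp add: D_def)
  qed
  show strict: "(x - t) * exp (h * (min x w - w)) < q x" if "x \<notin> {- u, v}"
    using that left_pos[of x] right_pos[of x] by (cases "x < w") (auto simp: D_def min_def)
  show "(x - t) * exp (h * (min x w - w)) \<le> q x"
  proof (cases "x \<in> {- u, v}")
    case True
    then show ?thesis using touch right_nonneg[of v] uv by (auto simp: min_def)
  qed (use strict in simp)
qed

section \<open>The optimal two-point law\<close>

text \<open>
  For \<open>u * v = V\<close> the function \<open>f\<close> is the tilted mean of the two-point law on \<open>{-u, v}\<close>, in terms of \<open>u\<close>
  alone; the constraint \<open>w \<le> v\<close> becomes \<open>u * w \<le> V\<close>.  The feasible set is neither closed at its lower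
  end nor always bounded, but \<open>f\<close> is positive on it, nonpositive at the excluded end point, and at most
  \<open>V / u\<close>, so the maximum over a suitable compact set is a maximum over all feasible \<open>u\<close>.
\<close>

lemma optimal_two_point_exists:
  fixes h w V :: real
  assumes h: "0 < h" and V: "0 < V"
  defines "f \<equiv> \<lambda>u. V * u * (1 - exp (- h * (u + w))) / (u\<^sup>2 + V * exp (- h * (u + w)))"
  obtains u where "0 < u" "- u < w" "u * w \<le> V" "0 < f u"
    "\<And>u'. 0 < u' \<Longrightarrow> - u' < w \<Longrightarrow> u' * w \<le> V \<Longrightarrow> f u' \<le> f u"
proof -
  have denom: "0 < u\<^sup>2 + V * exp (- h * (u + w))" for u
    using V by (intro add_nonneg_pos) auto
  have f_pos: "0 < f u" if "0 < u" "- u < w" for u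
    unfolding f_def using h V that denom[of u]
    by (intro divide_pos_pos mult_pos_pos) (auto simp: mult_less_0_iff)
  define u1 where "u1 = (if w \<le> 0 then 1 - w else V / w)"
  have u1: "0 < u1" "- u1 < w" "u1 * w \<le> V"
    using V by (auto simp: u1_def mult_nonneg_nonpos add_pos_nonneg intro: order_trans[of _ 0]
        less_trans[of _ 0])
  define m where "m = max 0 (- w)"
  \<comment> \<open>Beyond B, the bound V / u on f u is below the value f u1, which is attained.\<close>
  define B where "B = max u1 (V / f u1)"
  define K where "K = {m..B} \<inter> {u. u * w \<le> V}"
  have "compact K"
    unfolding K_def
    by (intro compact_Int_closed compact_Icc closed_Collect_le continuous_intros)
  moreover have "u1 \<in> K" using u1 by (auto simp: K_def m_def B_def)
  moreover have "continuous_on K f"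
    unfolding f_def using denom by (intro continuous_intros) (auto simp: less_le)
  ultimately obtain u where u: "u \<in> K" "\<And>y. y \<in> K \<Longrightarrow> f y \<le> f u"
    using continuous_attains_sup[of K f] by blast
  have fu: "0 < f u" using u(2)[OF \<open>u1 \<in> K\<close>] f_pos u1 by force
  \<comment> \<open>f vanishes at the left end of K.\<close>
  have "f m \<le> 0"
    unfolding f_def m_def using h V denom[of "max 0 (- w)"]
    by (auto simp: max_def)
  then have "u \<noteq> m" using fu by auto
  then have um: "m < u" using u(1) by (auto simp: K_def)
  show ?thesis
  proof (rule that[of u])
    show "0 < u" "- u < w" using um by (auto simp: m_def)
    show "u * w \<le> V" using u(1) by (simp add: K_def)
    show "0 < f u" by fact
    fix u' assume u': "0 < u'" "- u' < w" "u' * w \<le> V"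
    show "f u' \<le> f u"
    proof (cases "u' \<le> B")
      case True
      then show ?thesis using u' by (intro u(2)) (auto simp: K_def m_def)
    next
      case False
      have "f u' \<le> V * u' / u'\<^sup>2"
        unfolding f_def using u' V by (intro frac_le) auto
      also have "\<dots> = V / u'" using u' by (simp add: power2_eq_square)
      also have "\<dots> \<le> f u1"
        using False f_pos[OF u1(1,2)] u' by (auto simp: B_def pos_divide_le_eq mult.commute not_le
            pos_divide_less_eq less_imp_le)
      also have "\<dots> \<le> f u" using u(2) \<open>u1 \<in> K\<close> .
      finally show ?thesis .
    qed
  qed
qed

text \<open>
  The inequality \<open>\<phi> y \<le> 0\<close> is \<open>f y \<le> t\<close>, with \<open>f\<close> as in the previous lemma, after clearing the
  denominator, so the maximum of \<open>f\<close> with value \<open>t\<close> becomes a maximum of \<open>\<phi>\<close> with value 0.  Every feasible \<open>u\<close> can be decreased a little, which gives the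
  sign of \<open>\<phi>'\<close>; it can be increased as well unless \<open>u * w = V\<close>, that is, unless \<open>v = w\<close>.
\<close>

lemma first_order_conditions:
  fixes h w V u t :: real
  assumes h: "0 < h" and V: "0 < V" and u: "0 < u" "- u < w" "u * w \<le> V"
  defines "\<phi> \<equiv> \<lambda>y. V * y * (1 - exp (- h * (y + w))) - t * (y\<^sup>2 + V * exp (- h * (y + w)))"
    and "\<phi>' \<equiv> V * (1 - exp (- h * (u + w))) + V * u * h * exp (- h * (u + w))
      - 2 * t * u + t * V * h * exp (- h * (u + w))"
  assumes zero: "\<phi> u = 0"
    and max: "\<And>y. 0 < y \<Longrightarrow> - y < w \<Longrightarrow> y * w \<le> V \<Longrightarrow> \<phi> y \<le> 0"
  shows "0 \<le> \<phi>'" and "u * w < V \<Longrightarrow> \<phi>' = 0"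
proof -
  have der: "(\<phi> has_real_derivative \<phi>') (at u)"
    unfolding \<phi>_def \<phi>'_def
    by (rule derivative_eq_intros refl | simp add: algebra_simps)+
  show nonneg: "0 \<le> \<phi>'"
  proof (rule ccontr)
    assume "\<not> 0 \<le> \<phi>'"
    then obtain d where d: "0 < d" "\<And>k. 0 < k \<Longrightarrow> k < d \<Longrightarrow> \<phi> u < \<phi> (u - k)"
      using DERIV_neg_dec_left[OF der] by auto
    define k where "k = min d (min u (u + w)) / 2"
    have k: "0 < k" "k < d" "k < u" "k < u + w" using d u by (auto simp: k_def)
    have "(u - k) * w \<le> V"
    proof (cases "0 \<le> w")
      case True
      then have "(u - k) * w \<le> u * w" using k by (intro mult_right_mono) auto
      then show ?thesis using u by simp
    next
      case False
      then have "(u - k) * w \<le> 0" using k by (intro mult_nonneg_nonpos) auto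
      then show ?thesis using V by simp
    qed
    then have "\<phi> (u - k) \<le> 0" using k by (intro max) auto
    then show False using d(2)[OF k(1,2)] zero by simp
  qed
  show "\<phi>' = 0" if strict: "u * w < V"
  proof (rule ccontr)
    assume "\<phi>' \<noteq> 0"
    then have "0 < \<phi>'" using nonneg by simp
    then obtain d where d: "0 < d" "\<And>k. 0 < k \<Longrightarrow> k < d \<Longrightarrow> \<phi> u < \<phi> (u + k)"
      using DERIV_pos_inc_right[OF der] by auto
    define e where "e = (V - u * w) / (\<bar>w\<bar> + 1)"
    have "0 < e" using strict by (auto simp: e_def intro!: divide_pos_pos)
    define k where "k = min d e / 2"
    have k: "0 < k" "k < d" "k \<le> e"
      using d(1) \<open>0 < e\<close> by (auto simp: k_def)
    have "k * w \<le> k * (\<bar>w\<bar> + 1)" using k by (intro mult_left_mono) auto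
    also have "\<dots> \<le> V - u * w" using k(3) by (simp add: e_def pos_le_divide_eq)
    finally have "(u + k) * w \<le> V" by (simp add: algebra_simps)
    then have "\<phi> (u + k) \<le> 0" using k u by (intro max) auto
    then show False using d(2)[OF k(1,2)] zero by simp
  qed
qed

section \<open>The laws and their integrals\<close>

lemma has_bochner_integral_two_point:
  fixes f :: "real \<Rightarrow> real"
  assumes uv: "0 < u" "0 < v" and [measurable]: "f \<in> borel_measurable borel"
  shows "has_bochner_integral (two_point u v) f ((v * f (- u) + u * f v) / (u + v))"
proof -
  let ?B = "measure_pmf (bernoulli_pmf (u / (u + v)))"
  have p: "0 \<le> u / (u + v)" "u / (u + v) \<le> 1" using uv by auto
  have "integrable (two_point u v) f"
    unfolding two_point_eq[OF uv]
    by (subst integrable_distr_eq) (auto intro!: integrable_measure_pmf_finite)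
  moreover have "(\<integral>x. f x \<partial>two_point u v) = (\<integral>b. f (if b then v else - u) \<partial>?B)"
    unfolding two_point_eq[OF uv] by (subst integral_distr) auto
  moreover have "\<dots> = (v * f (- u) + u * f v) / (u + v)"
  proof -
    have "1 - u / (u + v) = v / (u + v)" using uv by (simp add: diff_divide_eq_iff)
    then show ?thesis using p by (simp add: add_divide_distrib mult.commute)
  qed
  ultimately show ?thesis by (simp add: has_bochner_integral_iff)
qed

lemma two_point_in_prob_eq:
  assumes uv: "0 < u" "0 < v" and V: "u * v = \<sigma>\<^sup>2"
  shows "two_point u v \<in> prob_eq \<sigma>"
proof -
  have "real_distribution (two_point u v)" "zero_mean (two_point u v)"
    using two_point_exists[OF uv] by (simp_all add: two_point_eq[OF uv])
  moreover have "has_bochner_integral (two_point u v) (\<lambda>x. x\<^sup>2) ((v * (- u)\<^sup>2 + u * v\<^sup>2) / (u + v))"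
    by (rule has_bochner_integral_two_point[OF uv]) simp
  moreover have "(v * (- u)\<^sup>2 + u * v\<^sup>2) / (u + v) = \<sigma>\<^sup>2"
  proof -
    have "v * (- u)\<^sup>2 + u * v\<^sup>2 = \<sigma>\<^sup>2 * (u + v)"
      unfolding V[symmetric] by (simp add: algebra_simps power2_eq_square)
    then show ?thesis using uv by simp
  qed
  ultimately show ?thesis
    by (simp add: prob_eq_def has_bochner_integral_iff)
qed

lemma prob_eq_subset_prob_le: "0 < \<sigma> \<Longrightarrow> s \<in> {0<..\<sigma>} \<Longrightarrow> prob_eq s \<subseteq> prob_le \<sigma>"
  by (auto simp: prob_eq_def prob_le_def power2_le_iff_abs_le abs_le_square_iff[symmetric])

lemma prob2_eq_subset_prob2_le: "0 < \<sigma> \<Longrightarrow> prob2_eq w \<sigma> \<subseteq> prob2_le w \<sigma>"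
  by (fastforce simp: prob2_eq_def prob2_le_def)

lemma prob2_eq_subset_prob_eq:
  assumes "0 < \<sigma>" shows "prob2_eq w \<sigma> \<subseteq> prob_eq \<sigma>"
proof
  fix P assume "P \<in> prob2_eq w \<sigma>"
  then obtain u v where P: "P = two_point u v" "- u < w" "w \<le> v" "u * v = \<sigma>\<^sup>2"
    by (auto simp: prob2_eq_def)
  then have "0 < u \<and> 0 < v" using assms by (intro two_point_params_pos) auto
  then show "P \<in> prob_eq \<sigma>" using P two_point_in_prob_eq by blast
qed

lemma prob2_le_subset_prob_le:
  assumes "0 < \<sigma>" shows "prob2_le w \<sigma> \<subseteq> prob_le \<sigma>"
proof
  fix P assume "P \<in> prob2_le w \<sigma>"
  then obtain u v where P: "P = two_point u v" "- u < w" "w \<le> v" "0 < u * v" "u * v \<le> \<sigma>\<^sup>2"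
    by (auto simp: prob2_le_def)
  then have uv: "0 < u" "0 < v" using two_point_params_pos by blast+
  have "two_point u v \<in> prob_eq (sqrt (u * v))"
    using uv by (intro two_point_in_prob_eq) auto
  moreover have "sqrt (u * v) \<in> {0<..\<sigma>}" using P assms by (auto intro: real_le_lsqrt)
  ultimately show "P \<in> prob_le \<sigma>" using prob_eq_subset_prob_le[OF assms] P by blast
qed

text \<open>
  Clearing the positive denominator turns a bound on the tilted mean into an inequality that is linear
  in \<open>P\<close>.  The harmless factor \<open>exp (- h * w)\<close> normalises the slope of \<open>g t\<close> on \<open>[w, \<infinity>)\<close> to 1.
\<close>

lemma wt_mean_le_iff:
  fixes P :: "real measure" and h t w :: real
  assumes "real_distribution P" "zero_mean P" "0 < h"
  defines "g \<equiv> \<lambda>t x. (x - t) * exp (h * (min x w - w))"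
  shows "integrable P (g t)"
    and "wt_mean h w P \<le> t \<longleftrightarrow> (\<integral>x. g t x \<partial>P) \<le> 0"
    and "wt_mean h w P = t \<longleftrightarrow> (\<integral>x. g t x \<partial>P) = 0"
proof -
  interpret real_distribution P by fact
  let ?e = "\<lambda>x. exp (h * min x w)"
  have e_le: "?e x \<le> exp (h * w)" for x using \<open>0 < h\<close> by simp
  have int_x: "integrable P (\<lambda>x. x)" using \<open>zero_mean P\<close> by (simp add: zero_mean_def)
  have int_e: "integrable P ?e"
    by (rule integrable_const_bound[where B = "exp (h * w)"]) (use e_le in auto)
  have int_xe: "integrable P (\<lambda>x. x * ?e x)"
  proof (rule Bochner_Integration.integrable_bound)
    show "integrable P (\<lambda>x. exp (h * w) * x)" using int_x by simp
    show "AE x in P. norm (x * ?e x) \<le> norm (exp (h * w) * x)"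
      using mult_left_mono[OF e_le abs_ge_zero] by (simp add: abs_mult mult.commute)
  qed simp
  have "(\<integral>x. ?e x \<partial>P) \<noteq> 0"
  proof
    assume "(\<integral>x. ?e x \<partial>P) = 0"
    then have "AE x in P. ?e x = 0"
      using integral_nonneg_eq_0_iff_AE[OF int_e] by auto
    then show False by simp
  qed
  moreover have "0 \<le> (\<integral>x. ?e x \<partial>P)" by (rule Bochner_Integration.integral_nonneg) simp
  ultimately have denom: "0 < (\<integral>x. ?e x \<partial>P)" by linarith
  have g: "g t = (\<lambda>x. exp (- h * w) * (x * ?e x - t * ?e x))"
    by (auto simp: g_def fun_eq_iff algebra_simps simp flip: exp_add)
  show "integrable P (g t)" unfolding g using int_e int_xe by simp
  have int_g: "(\<integral>x. g t x \<partial>P) = exp (- h * w) * ((\<integral>x. x * ?e x \<partial>P) - t * (\<integral>x. ?e x \<partial>P))"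
    unfolding g using int_e int_xe by simp
  show "wt_mean h w P \<le> t \<longleftrightarrow> (\<integral>x. g t x \<partial>P) \<le> 0"
    unfolding int_g wt_mean_def using denom by (simp add: mult_le_0_iff pos_divide_le_eq)
  show "wt_mean h w P = t \<longleftrightarrow> (\<integral>x. g t x \<partial>P) = 0"
    unfolding int_g wt_mean_def using denom by (auto simp: field_simps)
qed

section \<open>The common maximiser\<close>

text \<open>
  The certificate \<open>q x = (v - t) + s * (x - v) + c * (x - v)\<^sup>2\<close> is found as follows.  The slope of a
  parabola's chord is the mean of the slopes at its ends.  The chord of \<open>g\<close> over \<open>[-u, v]\<close> has slope
  \<open>1 - t / v\<close>, because \<open>t\<close> is the tilted mean of \<open>P\<^bsub>u,v\<^esub>\<close>, and at \<open>-u\<close> the slope of \<open>g\<close> is \<open>d\<close>.  So the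
  slope at \<open>v\<close> has to be \<open>s = 2 * (1 - t / v) - d\<close>, which fixes \<open>c\<close> as well.  The derivative in
  the first-order condition is \<open>V * (1 - 2 * t / v - d) = V * (s - 1)\<close>, so this condition amounts to
  \<open>s \<ge> 1\<close>, with equality when \<open>v > w\<close>.
\<close>

lemma unique_maximiser:
  fixes h \<sigma> w :: real
  assumes h: "0 < h" and \<sigma>: "0 < \<sigma>"
  obtains P\<^sub>0 where "P\<^sub>0 \<in> prob2_eq w \<sigma>"
    and "\<And>P. P \<in> prob_le \<sigma> \<Longrightarrow> wt_mean h w P \<le> wt_mean h w P\<^sub>0"
    and "\<And>P. P \<in> prob_le \<sigma> \<Longrightarrow> wt_mean h w P = wt_mean h w P\<^sub>0 \<Longrightarrow> P = P\<^sub>0"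
proof -
  define V where "V = \<sigma>\<^sup>2"
  have V: "0 < V" using \<sigma> by (simp add: V_def)
  define f where "f = (\<lambda>u. V * u * (1 - exp (- h * (u + w))) / (u\<^sup>2 + V * exp (- h * (u + w))))"
  obtain u where u: "0 < u" "- u < w" "u * w \<le> V" "0 < f u"
    and umax: "\<And>u'. 0 < u' \<Longrightarrow> - u' < w \<Longrightarrow> u' * w \<le> V \<Longrightarrow> f u' \<le> f u"
    using optimal_two_point_exists[OF h V, of w] unfolding f_def by blast
  define t v \<rho> where "t = f u" and "v = V / u" and "\<rho> = exp (- h * (u + w))"
  have denom: "0 < y\<^sup>2 + V * exp (- h * (y + w))" for y
    using V by (intro add_nonneg_pos) auto
  have t: "0 < t" using u by (simp add: t_def)
  have v: "0 < v" "w \<le> v" "u * v = V"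
    using u V by (auto simp: v_def field_simps)
  have zero: "V * u * (1 - \<rho>) - t * (u\<^sup>2 + V * \<rho>) = 0"
    using denom[of u] by (simp add: t_def f_def \<rho>_def)
  have "V * y * (1 - exp (- h * (y + w))) - t * (y\<^sup>2 + V * exp (- h * (y + w))) \<le> 0"
    if "0 < y" "- y < w" "y * w \<le> V" for y
    using umax[OF that] denom[of y] unfolding t_def[symmetric] by (simp add: f_def pos_divide_le_eq)
  note foc = first_order_conditions[OF h V u(1-3) zero[unfolded \<rho>_def] this, folded \<rho>_def]
  \<comment> \<open>The integral of g over the two-point law vanishes.\<close>
  have key: "v * (u + t) * \<rho> = u * (v - t)"
  proof -
    have "u * (v * (u + t) * \<rho>) = u * (u * (v - t))"
      using zero unfolding v(3)[symmetric] by (simp add: algebra_simps power2_eq_square)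
    then show ?thesis using u by simp
  qed
  define d where "d = (1 - h * (u + t)) * \<rho>"
  define s where "s = 2 * (1 - t / v) - d"
  define c where "c = (1 - t / v - d) / (u + v)"
  have slope: "V * (1 - \<rho>) + V * u * h * \<rho> - 2 * t * u + t * V * h * \<rho> = V * (1 - 2 * t / v - d)"
    (is "?\<phi> = _")
  proof -
    have "V * (1 - 2 * t / v - d) = V - 2 * t * u - V * d"
      using v u by (simp add: v(3)[symmetric] field_simps)
    then show ?thesis by (simp add: d_def algebra_simps)
  qed
  have d_le: "d \<le> 1 - 2 * t / v"
    using foc(1) V unfolding slope by (simp add: zero_le_mult_iff)
  have d_eq: "d = 1 - 2 * t / v" if "w < v"
  proof -
    have "u * w < V" using that u(1) by (simp add: v(3)[symmetric])
    then show ?thesis using foc(2) V unfolding slope by simp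
  qed
  have c: "0 < c"
  proof -
    have "0 < t / v" using t v by simp
    then show ?thesis using d_le u v by (auto simp: c_def)
  qed
  have s: "1 \<le> s" "v = w \<or> s = 1"
    using d_le d_eq v(2) by (simp_all add: s_def, linarith)
  define q where "q = (\<lambda>x. (v - t) + s * (x - v) + c * (x - v)\<^sup>2)"
  have exp_u: "exp (h * (- u - w)) = \<rho>" by (simp add: \<rho>_def algebra_simps)
  have cu: "c * (u + v) = 1 - t / v - d" using u v by (simp add: c_def)
  have q_u: "q (- u) = (- u - t) * \<rho>"
  proof -
    have "q (- u) = (v - t) - (u + v) * (s - c * (u + v))"
      by (simp add: q_def algebra_simps power2_eq_square)
    also have "s - c * (u + v) = 1 - t / v" by (simp add: cu s_def)
    also have "(v - t) - (u + v) * (1 - t / v) = - (u * (v - t) / v)"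
      using v by (simp add: field_simps)
    also have "\<dots> = (- u - t) * \<rho>"
      using v by (simp add: key[symmetric] field_simps)
    finally show ?thesis .
  qed
  have tangent: "s - 2 * c * (u + v) = (1 + h * (- u - t)) * \<rho>"
  proof -
    have "s - 2 * c * (u + v) = s - 2 * (c * (u + v))" by simp
    also have "\<dots> = d" by (simp add: cu s_def)
    finally show ?thesis by (simp add: d_def algebra_simps)
  qed
  define g where "g = (\<lambda>x. (x - t) * exp (h * (min x w - w)))"
  note major = parabola_majorant[OF h u(2) v(2) c s, of t, unfolded exp_u,
      OF q_u[unfolded q_def] tangent]
  have g_le: "g x \<le> q x" and g_less: "x \<notin> {- u, v} \<Longrightarrow> g x < q x" for x
    using major[of x] by (simp_all add: g_def q_def)
  define a b where "a = (v - t) - s * v + c * v\<^sup>2" and "b = s - 2 * c * v"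
  have q: "q = (\<lambda>x. a + b * x + c * x\<^sup>2)"
    by (simp add: q_def a_def b_def fun_eq_iff algebra_simps power2_eq_square)
  \<comment> \<open>A centred law of variance V gives q the integral a + c * V; the two-point law shows it is 0.\<close>
  have aV: "a + c * V = 0"
  proof -
    have "v * q (- u) + u * q v = (u + v) * (a + c * V)"
      unfolding q v(3)[symmetric] by (simp add: algebra_simps power2_eq_square)
    moreover have "q v = v - t" by (simp add: q_def)
    moreover have "v * ((- u - t) * \<rho>) + u * (v - t) = 0"
      using key by (simp add: algebra_simps)
    ultimately show ?thesis using q_u u v by simp
  qed
  define P\<^sub>0 where "P\<^sub>0 = two_point u v"
  have P0: "P\<^sub>0 \<in> prob2_eq w \<sigma>"
    using u v by (auto simp: prob2_eq_def P\<^sub>0_def V_def)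
  have dist0: "real_distribution P\<^sub>0" "measure P\<^sub>0 {- u, v} = 1" "zero_mean P\<^sub>0"
    using two_point_exists[OF u(1) v(1)] by (simp_all add: P\<^sub>0_def two_point_eq[OF u(1) v(1)])
  have mean0: "wt_mean h w P\<^sub>0 = t"
  proof -
    have "g \<in> borel_measurable borel" unfolding g_def by measurable
    then have "(\<integral>x. g x \<partial>P\<^sub>0) = (v * g (- u) + u * g v) / (u + v)"
      unfolding P\<^sub>0_def
      by (intro has_bochner_integral_integral_eq has_bochner_integral_two_point u v)
    also have "v * g (- u) + u * g v = u * (v - t) - v * (u + t) * \<rho>"
      using u v by (simp add: g_def exp_u min_absorb1 min_absorb2) (simp add: algebra_simps)
    finally have "(\<integral>x. g x \<partial>P\<^sub>0) = 0" using key by simp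
    then show ?thesis
      using wt_mean_le_iff(3)[OF dist0(1,3) h] unfolding g_def by simp
  qed
  have opt: "wt_mean h w P \<le> t \<and> (wt_mean h w P = t \<longrightarrow> P = P\<^sub>0)" if "P \<in> prob_le \<sigma>" for P
  proof -
    have P: "real_distribution P" "zero_mean P" "integrable P (\<lambda>x. x\<^sup>2)" "(\<integral>x. x\<^sup>2 \<partial>P) \<le> V"
      using that by (auto simp: prob_le_def V_def)
    interpret real_distribution P by fact
    have x: "integrable P (\<lambda>x. x)" "(\<integral>x. x \<partial>P) = 0" using P(2) by (auto simp: zero_mean_def)
    note g = wt_mean_le_iff[OF P(1,2) h, where t = t and w = w, folded g_def]
    have int_q: "integrable P q" unfolding q using x P(3) by simp
    have "(\<integral>x. q x \<partial>P) = a + c * (\<integral>x. x\<^sup>2 \<partial>P)"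
      unfolding q using x P(3) by (simp add: prob_space[simplified])
    also have "\<dots> \<le> a + c * V" using c P(4) by simp
    finally have q_le: "(\<integral>x. q x \<partial>P) \<le> 0" using aV by simp
    have diff: "(\<integral>x. q x - g x \<partial>P) = (\<integral>x. q x \<partial>P) - (\<integral>x. g x \<partial>P)"
      using int_q g(1) by simp
    have diff_nonneg: "0 \<le> (\<integral>x. q x - g x \<partial>P)"
      using g_le by (intro Bochner_Integration.integral_nonneg) auto
    have "P = P\<^sub>0" if "wt_mean h w P = t"
    proof -
      have "(\<integral>x. q x - g x \<partial>P) = 0"
        using that g(3) diff diff_nonneg q_le by simp
      then have "AE x in P. q x - g x = 0"
        using integral_nonneg_eq_0_iff_AE[of P "\<lambda>x. q x - g x"] int_q g(1) g_le by simp
      then have "AE x in P. x \<in> {- u, v}"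
        by eventually_elim (use g_less in force)
      then have "measure P {- u, v} = 1" by (subst (asm) AE_in_set_eq_1) auto
      then show ?thesis
        using two_point_unique[OF u(1) v(1) P(1) _ P(2) dist0] by simp
    qed
    then show ?thesis using g(2) diff diff_nonneg q_le by simp
  qed
  show ?thesis
    by (rule that[OF P0]) (use opt mean0 in auto)
qed

lemma unique_maximiser_sup_attain:
  assumes "P\<^sub>0 \<in> Q" "Q \<subseteq> R"
    and "\<And>P. P \<in> R \<Longrightarrow> wt_mean h w P \<le> wt_mean h w P\<^sub>0"
    and "\<And>P. P \<in> R \<Longrightarrow> wt_mean h w P = wt_mean h w P\<^sub>0 \<Longrightarrow> P = P\<^sub>0"
  shows "wt_sup h w Q = ereal (wt_mean h w P\<^sub>0)" and "wt_attain h w Q = {P\<^sub>0}"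
proof -
  show sup: "wt_sup h w Q = ereal (wt_mean h w P\<^sub>0)"
    unfolding wt_sup_def using assms by (intro antisym SUP_least SUP_upper) auto
  show "wt_attain h w Q = {P\<^sub>0}"
    unfolding wt_attain_def sup using assms by auto
qed

lemma common_maximiser:
  fixes h \<sigma> w :: real
  assumes h: "0 < h" and \<sigma>: "0 < \<sigma>"
  obtains P\<^sub>0 where "P\<^sub>0 \<in> prob_eq \<sigma>"
    and "\<And>P. P \<in> prob_le \<sigma> \<Longrightarrow> wt_mean h w P \<le> wt_mean h w P\<^sub>0"
    and "\<And>P. P \<in> prob_le \<sigma> \<Longrightarrow> wt_mean h w P = wt_mean h w P\<^sub>0 \<Longrightarrow> P = P\<^sub>0"
    and "\<And>Q. Q \<in> {prob_le \<sigma>, prob_eq \<sigma>, prob2_eq w \<sigma>, prob2_le w \<sigma>} \<Longrightarrow>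
      wt_sup h w Q = ereal (wt_mean h w P\<^sub>0) \<and> wt_attain h w Q = {P\<^sub>0}"
proof -
  obtain P\<^sub>0 where P0: "P\<^sub>0 \<in> prob2_eq w \<sigma>"
    and max: "\<And>P. P \<in> prob_le \<sigma> \<Longrightarrow> wt_mean h w P \<le> wt_mean h w P\<^sub>0"
      "\<And>P. P \<in> prob_le \<sigma> \<Longrightarrow> wt_mean h w P = wt_mean h w P\<^sub>0 \<Longrightarrow> P = P\<^sub>0"
    using unique_maximiser[OF h \<sigma>] by blast
  have eq_le: "prob_eq \<sigma> \<subseteq> prob_le \<sigma>" using prob_eq_subset_prob_le[OF \<sigma>, of \<sigma>] \<sigma> by simp
  note sub = eq_le prob2_eq_subset_prob_eq[OF \<sigma>, of w] prob2_le_subset_prob_le[OF \<sigma>, of w]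
    prob2_eq_subset_prob2_le[OF \<sigma>, of w]
  have sub_Q: "P\<^sub>0 \<in> Q \<and> Q \<subseteq> prob_le \<sigma>"
    if "Q \<in> {prob_le \<sigma>, prob_eq \<sigma>, prob2_eq w \<sigma>, prob2_le w \<sigma>}" for Q
    using that P0 sub by auto
  have "wt_sup h w Q = ereal (wt_mean h w P\<^sub>0) \<and> wt_attain h w Q = {P\<^sub>0}"
    if "Q \<in> {prob_le \<sigma>, prob_eq \<sigma>, prob2_eq w \<sigma>, prob2_le w \<sigma>}" for Q
  proof -
    have "P\<^sub>0 \<in> Q" "Q \<subseteq> prob_le \<sigma>" using sub_Q[OF that] by auto
    from unique_maximiser_sup_attain[OF this max] show ?thesis by (rule conjI)
  qed
  moreover have "P\<^sub>0 \<in> prob_eq \<sigma>" using P0 sub by blast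
  ultimately show thesis using max by (intro that)
qed

text \<open>
  The maximiser for \<open>r < s\<close> is admissible for \<open>s\<close>; having variance \<open>r\<^sup>2\<close> rather than \<open>s\<^sup>2\<close>, it differs
  from the unique maximiser there and so does strictly worse.
\<close>

lemma maximal_wt_mean_strict_mono:
  fixes h w :: real
  assumes h: "0 < h"
  shows "strict_mono_on {0<..} (\<lambda>s. wt_sup h w (prob_le s))"
proof (rule strict_mono_onI)
  fix r s :: real
  assume "r \<in> {0<..}" "s \<in> {0<..}" "r < s"
  then have r: "0 < r" and s: "0 < s" and rs: "r < s" by auto
  obtain P where P: "P \<in> prob_eq r" "wt_sup h w (prob_le r) = ereal (wt_mean h w P)"
    using common_maximiser[OF h r, of w] by (metis insertCI)
  obtain R where R: "R \<in> prob_eq s" "wt_sup h w (prob_le s) = ereal (wt_mean h w R)"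
    and max: "\<And>P. P \<in> prob_le s \<Longrightarrow> wt_mean h w P \<le> wt_mean h w R"
      "\<And>P. P \<in> prob_le s \<Longrightarrow> wt_mean h w P = wt_mean h w R \<Longrightarrow> P = R"
    using common_maximiser[OF h s, of w] by (metis insertCI)
  have "r\<^sup>2 \<noteq> s\<^sup>2" using r s rs by simp
  then have "P \<noteq> R" using P(1) R(1) by (auto simp: prob_eq_def)
  moreover have "P \<in> prob_le s" using prob_eq_subset_prob_le[OF s, of r] P(1) r rs by auto
  ultimately have "wt_mean h w P < wt_mean h w R" using max[of P] by fastforce
  then show "wt_sup h w (prob_le r) < wt_sup h w (prob_le s)" by (simp add: P(2) R(2))
qed

theorem theorem2p1:
  fixes h \<sigma> w :: real
  assumes "0 < h" and "0 < \<sigma>"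
  shows
    "(wt_sup h w (prob_le \<sigma>) = wt_sup h w (prob_eq \<sigma>) \<and>
      wt_sup h w (prob_eq \<sigma>) = wt_sup h w (prob2_eq w \<sigma>) \<and>
      wt_sup h w (prob2_eq w \<sigma>) = wt_sup h w (prob2_le w \<sigma>)) \<and>
     (strict_mono_on {0<..} (\<lambda>s::real. wt_sup h w (prob_le s)) \<and>
      strict_mono_on {0<..} (\<lambda>s::real. wt_sup h w (prob_eq s)) \<and>
      strict_mono_on {0<..} (\<lambda>s::real. wt_sup h w (prob2_eq w s)) \<and>
      strict_mono_on {0<..} (\<lambda>s::real. wt_sup h w (prob2_le w s))) \<and>
     (wt_attain h w (prob_le \<sigma>) \<noteq> {} \<and>
      wt_attain h w (prob_eq \<sigma>) \<noteq> {} \<and>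
      wt_attain h w (prob2_eq w \<sigma>) \<noteq> {} \<and>
      wt_attain h w (prob2_le w \<sigma>) \<noteq> {} \<and>
      wt_attain h w (prob_le \<sigma>) = wt_attain h w (prob_eq \<sigma>) \<and>
      wt_attain h w (prob_eq \<sigma>) = wt_attain h w (prob2_eq w \<sigma>) \<and>
      wt_attain h w (prob2_eq w \<sigma>) = wt_attain h w (prob2_le w \<sigma>))"
proof -
  have same_sup: "wt_sup h w (prob_le s) = wt_sup h w (prob_eq s) \<and>
      wt_sup h w (prob_eq s) = wt_sup h w (prob2_eq w s) \<and>
      wt_sup h w (prob2_eq w s) = wt_sup h w (prob2_le w s)" if "0 < s" for s
    by (rule common_maximiser[OF \<open>0 < h\<close> that, of w]) simp
  have mono: "strict_mono_on {0<..} (\<lambda>s. wt_sup h w (prob_le s))"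
    by (rule maximal_wt_mean_strict_mono) fact
  have transfer: "strict_mono_on {0<..} F"
    if "\<And>s. 0 < s \<Longrightarrow> F s = wt_sup h w (prob_le s)" for F :: "real \<Rightarrow> ereal"
    using mono that by (simp add: strict_mono_on_def)
  have "strict_mono_on {0<..} (\<lambda>s. wt_sup h w (prob_eq s))"
    "strict_mono_on {0<..} (\<lambda>s. wt_sup h w (prob2_eq w s))"
    "strict_mono_on {0<..} (\<lambda>s. wt_sup h w (prob2_le w s))"
    by (rule transfer, metis same_sup)+
  moreover obtain P\<^sub>0 where "\<And>Q. Q \<in> {prob_le \<sigma>, prob_eq \<sigma>, prob2_eq w \<sigma>, prob2_le w \<sigma>} \<Longrightarrow>
      wt_attain h w Q = {P\<^sub>0}"
    using common_maximiser[OF assms, of w] by metis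
  ultimately show ?thesis
    using same_sup[OF \<open>0 < \<sigma>\<close>] mono by simp
qed

end
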